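(* Let $\mathcal H$ be an infinite-dimensional Hilbert function space and let $\varphi$ be a pseudomultiplier of $\mathcal H$. Then $\mathcal P_\varphi=\overline{\mathbf D_\varphi}\setminus\mathbf D_\varphi$, where $\mathcal P_\varphi$ is the polar space of $\varphi$, $\mathbf D_\varphi$ is the set of definable vectors of $\varphi$, and the closure is taken in $\mathcal H$.
   Context: A Hilbert function space on a set $\Omega$ is a complex Hilbert space $\mathcal H$ whose elements are complex-valued functions on $\Omega$ (with pointwise operations) such that for each $\lambda\in\Omega$ the functional $f\mapsto f(\lambda)$ is continuous. A subset $D\subset\Omega$ is a set of uniqueness for $\mathcal H$ if any $f,g\in\mathcal H$ that agree on $D$ are equal. A function $\varphi:D_\varphi\subset\Omega\to\mathbb C$ is a pseudomultiplier of $\mathcal H$ if (1) $D_\varphi$ is a set of uniqueness for $\mathcal H$; (2) $E_\varphi=\{h\in\mathcal H:\text{ there exists } g\in\mathcal H \text{ with } g(\lambda)=\varphi(\lambda)h(\lambda)\text{ for all }\lambda\in D_\varphi\}$ is closed in $\mathcal H$; (3) $E_\varphi$ has finite codimension in $\mathcal H$. Seeing a vector: for $v\in\mathcal H$, let $p\notin\Omega$, and for $f\in\mathcal H$ define $f_v:\Omega\cup\{p\}\to\mathbb C$ by $f_v=f$ on $\Omega$ and $f_v(p)=\langle f,v\rangle$. Let $\mathcal H_v=\{f_v:f\in\mathcal H\}$ with $\langle f_v,g_v\rangle_{\mathcal H_v}=\langle f,g\rangle_{\mathcal H}$; this is a Hilbert function space on $\Omega\cup\{p\}$. The pseudomultiplier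 $\varphi$ of $\mathcal H$ sees $v$ with value $c\in\mathbb C$ if there exists a pseudomultiplier $\psi$ of $\mathcal H_v$ such that $D_\varphi\subseteq D_\psi$, $\psi|D_\varphi=\varphi$, $p\in D_\psi$, $E_\varphi=E_\psi|\Omega:=\{F|\Omega:F\in E_\psi\}$, and $\psi(p)=c$. $\varphi$ sees $v$ if it sees $v$ with some value $c$. Ambiguous vectors: $\mathcal A_\varphi$ is the set of $v\in\mathcal H$ such that $\varphi$ sees $v$ with value $c$ for every $c\in\mathbb C$. Definable vectors: $d\in\mathcal H$ is definable for $\varphi$ if $d\neq0$, $\varphi$ sees $d$, and $d\perp\mathcal A_\varphi$; $\mathbf D_\varphi$ is the set of definable vectors. For $d\in\mathbf D_\varphi$ there is a unique $c\in\mathbb C$ such that $\varphi$ sees $d$ with value $c$; it is denoted $\varphi(d)$. Polar vectors: $q\in\mathcal H$ is a polar vector for $\varphi$ if $q\ne0$ and there is a sequence $(d_n)$ in $\mathbf D_\varphi$ with $d_n\to q$ in norm and $\varphi(d_n)\to\infty$ (i.e. $|\varphi(d_n)|\to\infty$). The polar space $\mathcal P_\varphi$ is the set consisting of the polar vectors of $\varphi$ together with $0$. *)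

theory Defs
  imports "HOL-Analysis.Analysis" "HOL-Library.Function_Algebras"
begin

text \<open>
  The vector space operations on \<^typ>\<open>'a \<Rightarrow> complex\<close> are the pointwise ones: \<open>+\<close>, \<open>-\<close> and \<open>0\<close> come from
  \<^theory>\<open>HOL-Library.Function_Algebras\<close>, and scalar multiplication is \<open>cscale\<close>.
\<close>

definition cscale :: "complex \<Rightarrow> ('a \<Rightarrow> complex) \<Rightarrow> 'a \<Rightarrow> complex" where
  "cscale c f = (\<lambda>x. c * f x)"

global_interpretation cfun: vector_space "cscale :: complex \<Rightarrow> ('a \<Rightarrow> complex) \<Rightarrow> 'a \<Rightarrow> complex"
  by unfold_locales (auto simp: cscale_def fun_eq_iff algebra_simps)

definition ip_norm :: "(('a \<Rightarrow> complex) \<Rightarrow> ('a \<Rightarrow> complex) \<Rightarrow> complex) \<Rightarrow> ('a \<Rightarrow> complex) \<Rightarrow> real" where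
  "ip_norm ip f = sqrt (Re (ip f f))"

text \<open>
  The locale \<^locale>\<open>Metric_space\<close> requires symmetry and nonnegativity of the metric also off its
  carrier, where nothing is known about the inner product; hence the conditional.
\<close>

definition ip_dist ::
  "('a \<Rightarrow> complex) set \<Rightarrow> (('a \<Rightarrow> complex) \<Rightarrow> ('a \<Rightarrow> complex) \<Rightarrow> complex)
    \<Rightarrow> ('a \<Rightarrow> complex) \<Rightarrow> ('a \<Rightarrow> complex) \<Rightarrow> real" where
  "ip_dist H ip f g = (if f \<in> H \<and> g \<in> H then ip_norm ip (f - g) else 0)"

definition norm_topology ::
  "('a \<Rightarrow> complex) set \<Rightarrow> (('a \<Rightarrow> complex) \<Rightarrow> ('a \<Rightarrow> complex) \<Rightarrow> complex) \<Rightarrow> ('a \<Rightarrow> complex) topology" where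
  "norm_topology H ip = Metric_space.mtopology H (ip_dist H ip)"

text \<open>
  A function on \<open>\<Omega>\<close> is represented by its extension by \<open>0\<close> to the whole type, so that
  equality and the pointwise operations agree with those of functions on \<open>\<Omega>\<close>.
  The inner product is linear in its first argument.
\<close>

locale hilbert_function_space =
  fixes \<Omega> :: "'a set"
    and H :: "('a \<Rightarrow> complex) set"
    and ip :: "('a \<Rightarrow> complex) \<Rightarrow> ('a \<Rightarrow> complex) \<Rightarrow> complex"
  assumes zero_outside: "\<And>f x. f \<in> H \<Longrightarrow> x \<notin> \<Omega> \<Longrightarrow> f x = 0"
    and subspace: "cfun.subspace H"
    and ip_add: "\<And>f g h. f \<in> H \<Longrightarrow> g \<in> H \<Longrightarrow> h \<in> H \<Longrightarrow> ip (f + g) h = ip f h + ip g h"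
    and ip_cscale: "\<And>c f g. f \<in> H \<Longrightarrow> g \<in> H \<Longrightarrow> ip (cscale c f) g = c * ip f g"
    and ip_cnj: "\<And>f g. f \<in> H \<Longrightarrow> g \<in> H \<Longrightarrow> ip g f = cnj (ip f g)"
    and ip_pos: "\<And>f. f \<in> H \<Longrightarrow> f \<noteq> 0 \<Longrightarrow> Re (ip f f) > 0"
    and complete: "Metric_space.mcomplete H (ip_dist H ip)"
    and continuous_eval: "\<And>x. x \<in> \<Omega> \<Longrightarrow> continuous_map (norm_topology H ip) euclidean (\<lambda>f. f x)"

definition infinite_dimensional :: "('a \<Rightarrow> complex) set \<Rightarrow> bool" where
  "infinite_dimensional H \<longleftrightarrow> \<not> (\<exists>B. finite B \<and> B \<subseteq> H \<and> H \<subseteq> cfun.span B)"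

text \<open>Finite codimension: the classes of finitely many vectors of \<open>H\<close> span the quotient \<open>H / E\<close>.\<close>

definition finite_codimension :: "('a \<Rightarrow> complex) set \<Rightarrow> ('a \<Rightarrow> complex) set \<Rightarrow> bool" where
  "finite_codimension H E \<longleftrightarrow>
    cfun.subspace E \<and> E \<subseteq> H \<and>
    (\<exists>B. finite B \<and> B \<subseteq> H \<and> (\<forall>h\<in>H. \<exists>e\<in>E. \<exists>b\<in>cfun.span B. h = e + b))"

definition uniqueness_set :: "'a set \<Rightarrow> ('a \<Rightarrow> complex) set \<Rightarrow> 'a set \<Rightarrow> bool" where
  "uniqueness_set \<Omega> H D \<longleftrightarrow>
    D \<subseteq> \<Omega> \<and> (\<forall>f\<in>H. \<forall>g\<in>H. (\<forall>x\<in>D. f x = g x) \<longrightarrow> f = g)"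

text \<open>A function \<open>\<phi>\<close> defined on a subset of \<open>\<Omega>\<close> is a partial map, with \<open>D\<^sub>\<phi>\<close> given by \<^term>\<open>dom \<phi>\<close>.\<close>

definition mult_domain :: "('a \<Rightarrow> complex) set \<Rightarrow> ('a \<rightharpoonup> complex) \<Rightarrow> ('a \<Rightarrow> complex) set" where
  "mult_domain H \<phi> = {h \<in> H. \<exists>g\<in>H. \<forall>x\<in>dom \<phi>. g x = the (\<phi> x) * h x}"

definition pseudomultiplier ::
  "'a set \<Rightarrow> ('a \<Rightarrow> complex) set \<Rightarrow> (('a \<Rightarrow> complex) \<Rightarrow> ('a \<Rightarrow> complex) \<Rightarrow> complex)
    \<Rightarrow> ('a \<rightharpoonup> complex) \<Rightarrow> bool" where
  "pseudomultiplier \<Omega> H ip \<phi> \<longleftrightarrow>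
    uniqueness_set \<Omega> H (dom \<phi>) \<and>
    closedin (norm_topology H ip) (mult_domain H \<phi>) \<and>
    finite_codimension H (mult_domain H \<phi>)"

text \<open>
  The space \<open>\<H>\<^sub>v\<close> lives on \<open>\<Omega> \<union> {p}\<close>, realised inside \<^typ>\<open>'a option\<close> with \<open>p\<close> being \<^term>\<open>None\<close>;
  restriction to \<open>\<Omega>\<close> is composition with \<^term>\<open>Some\<close>.
\<close>

definition ext_points :: "'a set \<Rightarrow> 'a option set" where
  "ext_points \<Omega> = insert None (Some ` \<Omega>)"

definition ext_fun ::
  "(('a \<Rightarrow> complex) \<Rightarrow> ('a \<Rightarrow> complex) \<Rightarrow> complex) \<Rightarrow> ('a \<Rightarrow> complex) \<Rightarrow> ('a \<Rightarrow> complex)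
    \<Rightarrow> 'a option \<Rightarrow> complex" where
  "ext_fun ip v f = case_option (ip f v) f"

definition ext_space ::
  "('a \<Rightarrow> complex) set \<Rightarrow> (('a \<Rightarrow> complex) \<Rightarrow> ('a \<Rightarrow> complex) \<Rightarrow> complex) \<Rightarrow> ('a \<Rightarrow> complex)
    \<Rightarrow> ('a option \<Rightarrow> complex) set" where
  "ext_space H ip v = ext_fun ip v ` H"

definition ext_ip ::
  "(('a \<Rightarrow> complex) \<Rightarrow> ('a \<Rightarrow> complex) \<Rightarrow> complex)
    \<Rightarrow> ('a option \<Rightarrow> complex) \<Rightarrow> ('a option \<Rightarrow> complex) \<Rightarrow> complex" where
  "ext_ip ip F G = ip (F \<circ> Some) (G \<circ> Some)"

definition sees_with_value ::
  "'a set \<Rightarrow> ('a \<Rightarrow> complex) set \<Rightarrow> (('a \<Rightarrow> complex) \<Rightarrow> ('a \<Rightarrow> complex) \<Rightarrow> complex)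
    \<Rightarrow> ('a \<rightharpoonup> complex) \<Rightarrow> ('a \<Rightarrow> complex) \<Rightarrow> complex \<Rightarrow> bool" where
  "sees_with_value \<Omega> H ip \<phi> v c \<longleftrightarrow>
    (\<exists>\<psi>. pseudomultiplier (ext_points \<Omega>) (ext_space H ip v) (ext_ip ip) \<psi> \<and>
         Some ` dom \<phi> \<subseteq> dom \<psi> \<and>
         (\<forall>x\<in>dom \<phi>. \<psi> (Some x) = \<phi> x) \<and>
         None \<in> dom \<psi> \<and>
         mult_domain H \<phi> = (\<lambda>F. F \<circ> Some) ` mult_domain (ext_space H ip v) \<psi> \<and>
         \<psi> None = Some c)"

definition sees ::
  "'a set \<Rightarrow> ('a \<Rightarrow> complex) set \<Rightarrow> (('a \<Rightarrow> complex) \<Rightarrow> ('a \<Rightarrow> complex) \<Rightarrow> complex)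
    \<Rightarrow> ('a \<rightharpoonup> complex) \<Rightarrow> ('a \<Rightarrow> complex) \<Rightarrow> bool" where
  "sees \<Omega> H ip \<phi> v \<longleftrightarrow> (\<exists>c. sees_with_value \<Omega> H ip \<phi> v c)"

definition ambiguous_vectors ::
  "'a set \<Rightarrow> ('a \<Rightarrow> complex) set \<Rightarrow> (('a \<Rightarrow> complex) \<Rightarrow> ('a \<Rightarrow> complex) \<Rightarrow> complex)
    \<Rightarrow> ('a \<rightharpoonup> complex) \<Rightarrow> ('a \<Rightarrow> complex) set" where
  "ambiguous_vectors \<Omega> H ip \<phi> = {v \<in> H. \<forall>c. sees_with_value \<Omega> H ip \<phi> v c}"

definition definable_vectors ::
  "'a set \<Rightarrow> ('a \<Rightarrow> complex) set \<Rightarrow> (('a \<Rightarrow> complex) \<Rightarrow> ('a \<Rightarrow> complex) \<Rightarrow> complex)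
    \<Rightarrow> ('a \<rightharpoonup> complex) \<Rightarrow> ('a \<Rightarrow> complex) set" where
  "definable_vectors \<Omega> H ip \<phi> =
    {d \<in> H. d \<noteq> 0 \<and> sees \<Omega> H ip \<phi> d \<and> (\<forall>a\<in>ambiguous_vectors \<Omega> H ip \<phi>. ip d a = 0)}"

definition value_at ::
  "'a set \<Rightarrow> ('a \<Rightarrow> complex) set \<Rightarrow> (('a \<Rightarrow> complex) \<Rightarrow> ('a \<Rightarrow> complex) \<Rightarrow> complex)
    \<Rightarrow> ('a \<rightharpoonup> complex) \<Rightarrow> ('a \<Rightarrow> complex) \<Rightarrow> complex" where
  "value_at \<Omega> H ip \<phi> d = (THE c. sees_with_value \<Omega> H ip \<phi> d c)"

definition polar_vector ::
  "'a set \<Rightarrow> ('a \<Rightarrow> complex) set \<Rightarrow> (('a \<Rightarrow> complex) \<Rightarrow> ('a \<Rightarrow> complex) \<Rightarrow> complex)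
    \<Rightarrow> ('a \<rightharpoonup> complex) \<Rightarrow> ('a \<Rightarrow> complex) \<Rightarrow> bool" where
  "polar_vector \<Omega> H ip \<phi> q \<longleftrightarrow>
    q \<in> H \<and> q \<noteq> 0 \<and>
    (\<exists>d :: nat \<Rightarrow> 'a \<Rightarrow> complex.
       (\<forall>n. d n \<in> definable_vectors \<Omega> H ip \<phi>) \<and>
       (\<lambda>n. ip_norm ip (d n - q)) \<longlonglongrightarrow> 0 \<and>
       filterlim (\<lambda>n. value_at \<Omega> H ip \<phi> (d n)) at_infinity sequentially)"

definition polar_space ::
  "'a set \<Rightarrow> ('a \<Rightarrow> complex) set \<Rightarrow> (('a \<Rightarrow> complex) \<Rightarrow> ('a \<Rightarrow> complex) \<Rightarrow> complex)
    \<Rightarrow> ('a \<rightharpoonup> complex) \<Rightarrow> ('a \<Rightarrow> complex) set" where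
  "polar_space \<Omega> H ip \<phi> = insert 0 {q. polar_vector \<Omega> H ip \<phi> q}"

end

theory Submission imports Defs begin

text \<open>
  Write \<open>E\<close> for the domain space of \<open>\<phi>\<close> and \<open>X h\<close> for the element of \<open>\<H>\<close> that agrees with \<open>\<phi> h\<close> on
  \<open>D\<^sub>\<phi>\<close>, for \<open>h \<in> E\<close>.  The key observation (\<open>sees_with_value_iff\<close>) removes the extended spaces
  altogether: \<open>\<phi>\<close> sees \<open>v\<close> with value \<open>c\<close> if and only if \<open>\<langle>X h, v\<rangle> = c \<langle>h, v\<rangle>\<close> for all \<open>h \<in> E\<close>.
  Consequently the ambiguous vectors are those orthogonal to both \<open>E\<close> and \<open>X E\<close>, and they form a
  closed subspace.

  Let definable \<open>d\<^sub>n\<close> converge to \<open>q \<noteq> 0\<close>; orthogonality to the ambiguous vectors passes to \<open>q\<close>.  If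
  the values \<open>\<phi>(d\<^sub>n)\<close> tend to infinity, then \<open>\<langle>h, d\<^sub>n\<rangle> = \<langle>X h, d\<^sub>n\<rangle> / \<phi>(d\<^sub>n)\<close> forces \<open>q \<bottom> E\<close>; a definable
  such \<open>q\<close> would satisfy \<open>q \<bottom> X E\<close> too, so it would be ambiguous and orthogonal to itself
  (\<open>polar_not_definable\<close>).  If they do not tend to infinity, a subsequence has convergent values, and
  \<open>\<langle>X h, d\<^sub>n\<rangle> = \<phi>(d\<^sub>n) \<langle>h, d\<^sub>n\<rangle>\<close> passes to the limit along it, so \<open>q\<close> is definable
  (\<open>limit_of_definable_values_tend_to_infinity\<close>).  This settles all nonzero vectors.

  The zero vector is never definable, and since nonzero multiples of definable vectors are definable,
  it lies in the closure as soon as one definable vector exists.  This is where infinite dimension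
  enters (\<open>definable_exists\<close>): the component of a suitable reproducing kernel orthogonal to the
  ambiguous vectors is definable.  Both the kernel and that component come from the projection
  theorem (\<open>orthogonal_projection_exists\<close>).
\<close>

section \<open>Elementary Hilbert space geometry\<close>

context hilbert_function_space
begin

lemma zero_mem: "0 \<in> H"
  using subspace by (rule cfun.subspace_0)

lemma add_mem: "f \<in> H \<Longrightarrow> g \<in> H \<Longrightarrow> f + g \<in> H"
  using subspace by (rule cfun.subspace_add)

lemma diff_mem: "f \<in> H \<Longrightarrow> g \<in> H \<Longrightarrow> f - g \<in> H"
  using subspace by (rule cfun.subspace_diff)

lemma cscale_mem: "f \<in> H \<Longrightarrow> cscale c f \<in> H"
  using subspace by (rule cfun.subspace_scale)

lemma ip_zero_left: "g \<in> H \<Longrightarrow> ip 0 g = 0"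
  using ip_cscale[of 0 g 0] zero_mem by simp

lemma ip_zero_right: "g \<in> H \<Longrightarrow> ip g 0 = 0"
  using ip_zero_left[of g] ip_cnj[of 0 g] zero_mem by simp

lemma ip_diff_left:
  assumes "f \<in> H" "g \<in> H" "h \<in> H"
  shows "ip (f - g) h = ip f h - ip g h"
  using ip_add[of "f - g" g h] assms diff_mem by simp

lemma ip_add_right:
  assumes "f \<in> H" "g \<in> H" "h \<in> H"
  shows "ip h (f + g) = ip h f + ip h g"
  using ip_add[OF assms] ip_cnj assms add_mem by (metis complex_cnj_add)

lemma ip_diff_right:
  assumes "f \<in> H" "g \<in> H" "h \<in> H"
  shows "ip h (f - g) = ip h f - ip h g"
  using ip_diff_left[OF assms] ip_cnj assms diff_mem by (metis complex_cnj_diff)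

lemma ip_cscale_right:
  assumes "f \<in> H" "g \<in> H"
  shows "ip f (cscale c g) = cnj c * ip f g"
  using ip_cscale[of g f c] ip_cnj assms cscale_mem by (metis complex_cnj_mult)

lemma Re_ip_nonneg: "f \<in> H \<Longrightarrow> 0 \<le> Re (ip f f)"
  using ip_pos[of f] ip_zero_left[OF zero_mem] by (cases "f = 0") auto

lemma ip_norm_nonneg: "f \<in> H \<Longrightarrow> 0 \<le> ip_norm ip f"
  by (simp add: ip_norm_def Re_ip_nonneg)

lemma ip_self: "f \<in> H \<Longrightarrow> ip f f = complex_of_real ((ip_norm ip f)\<^sup>2)"
  using ip_cnj[of f f] Re_ip_nonneg[of f]
  by (auto simp: ip_norm_def complex_eq_iff)

lemma ip_norm_eq_0_iff: "f \<in> H \<Longrightarrow> ip_norm ip f = 0 \<longleftrightarrow> f = 0"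
  using ip_pos[of f] ip_zero_left[OF zero_mem] by (cases "f = 0") (auto simp: ip_norm_def)

lemma ip_self_eq_0_iff: "f \<in> H \<Longrightarrow> ip f f = 0 \<longleftrightarrow> f = 0"
  by (simp add: ip_self ip_norm_eq_0_iff)

lemma ip_norm_cscale: "f \<in> H \<Longrightarrow> ip_norm ip (cscale c f) = cmod c * ip_norm ip f"
proof -
  assume f: "f \<in> H"
  have "ip (cscale c f) (cscale c f) = complex_of_real ((cmod c * ip_norm ip f)\<^sup>2)"
    using f by (simp add: ip_cscale ip_cscale_right cscale_mem ip_self[OF f] power_mult_distrib
        complex_norm_square[symmetric] ac_simps)
  then have "Re (ip (cscale c f) (cscale c f)) = (cmod c * ip_norm ip f)\<^sup>2"
    by (metis Re_complex_of_real)
  moreover have "0 \<le> cmod c * ip_norm ip f"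
    by (simp add: ip_norm_nonneg f)
  ultimately show ?thesis
    by (simp only: ip_norm_def[of ip "cscale c f"] real_sqrt_abs abs_of_nonneg)
qed

lemma ip_norm_diff_commute:
  assumes "f \<in> H" "g \<in> H"
  shows "ip_norm ip (f - g) = ip_norm ip (g - f)"
proof -
  have "g - f = cscale (-1) (f - g)"
    by (simp add: cscale_def fun_eq_iff)
  then have "ip_norm ip (g - f) = cmod (-1) * ip_norm ip (f - g)"
    using assms by (simp only: ip_norm_cscale diff_mem)
  then show ?thesis
    by simp
qed

text \<open>Pythagoras for the component of \<open>f\<close> orthogonal to the line through \<open>g\<close>.\<close>

lemma ip_norm_residual:
  assumes f: "f \<in> H" and g: "g \<in> H" "g \<noteq> 0"
  shows "(ip_norm ip (f - cscale (ip f g / ip g g) g))\<^sup>2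
    = (ip_norm ip f)\<^sup>2 - (cmod (ip f g))\<^sup>2 / (ip_norm ip g)\<^sup>2"
proof -
  define t where "t = ip f g / ip g g"
  have nz: "ip g g \<noteq> 0"
    using g ip_self_eq_0_iff by blast
  have tg: "cscale t g \<in> H"
    using g cscale_mem by blast
  have "ip (f - cscale t g) g = 0"
    using f g nz tg by (simp add: ip_diff_left ip_cscale t_def)
  then have "ip (f - cscale t g) (f - cscale t g) = ip (f - cscale t g) f"
    using f g tg by (simp add: ip_diff_right ip_cscale_right diff_mem)
  also have "\<dots> = ip f f - t * cnj (ip f g)"
    using f g tg by (simp add: ip_diff_left ip_cscale ip_cnj[OF f g(1)])
  also have "\<dots> = complex_of_real ((ip_norm ip f)\<^sup>2 - (cmod (ip f g))\<^sup>2 / (ip_norm ip g)\<^sup>2)"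
    using f g by (simp add: t_def ip_self complex_norm_square del: of_real_power)
  finally show ?thesis
    using ip_self[OF diff_mem[OF f tg]] unfolding t_def
    by (metis of_real_eq_iff)
qed

lemma Cauchy_Schwarz_ip:
  assumes "f \<in> H" "g \<in> H"
  shows "cmod (ip f g) \<le> ip_norm ip f * ip_norm ip g"
proof (cases "g = 0")
  case True
  then show ?thesis
    using assms ip_norm_eq_0_iff[OF assms(2)] by (simp add: ip_zero_right)
next
  case False
  have pos: "0 < ip_norm ip g"
    using False assms ip_norm_nonneg ip_norm_eq_0_iff by (metis less_eq_real_def)
  have "0 \<le> (ip_norm ip f)\<^sup>2 - (cmod (ip f g))\<^sup>2 / (ip_norm ip g)\<^sup>2"
    using ip_norm_residual[OF assms False] by (metis zero_le_power2)
  then have "(cmod (ip f g))\<^sup>2 \<le> (ip_norm ip f * ip_norm ip g)\<^sup>2"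
    using pos by (simp add: field_simps power_mult_distrib)
  then show ?thesis
    by (rule power2_le_imp_le) (simp add: assms ip_norm_nonneg)
qed

lemma ip_norm_add_sq:
  assumes "f \<in> H" "g \<in> H"
  shows "(ip_norm ip (f + g))\<^sup>2 = (ip_norm ip f)\<^sup>2 + (ip_norm ip g)\<^sup>2 + 2 * Re (ip f g)"
proof -
  have "ip (f + g) (f + g) = ip f f + ip g g + (ip f g + cnj (ip f g))"
    using assms ip_cnj[OF assms] by (simp add: ip_add ip_add_right add_mem)
  then have "Re (ip (f + g) (f + g)) = Re (ip f f) + Re (ip g g) + 2 * Re (ip f g)"
    by simp
  then show ?thesis
    using assms by (simp add: ip_self add_mem Re_complex_of_real del: of_real_power)
qed

lemma ip_norm_triangle:
  assumes "f \<in> H" "g \<in> H"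
  shows "ip_norm ip (f + g) \<le> ip_norm ip f + ip_norm ip g"
proof (rule power2_le_imp_le)
  have "Re (ip f g) \<le> ip_norm ip f * ip_norm ip g"
    using Cauchy_Schwarz_ip[OF assms] complex_Re_le_cmod order_trans by blast
  then show "(ip_norm ip (f + g))\<^sup>2 \<le> (ip_norm ip f + ip_norm ip g)\<^sup>2"
    by (simp add: ip_norm_add_sq[OF assms] power2_sum)
qed (simp add: assms ip_norm_nonneg)

lemma parallelogram_law:
  assumes "f \<in> H" "g \<in> H"
  shows "(ip_norm ip (f + g))\<^sup>2 + (ip_norm ip (f - g))\<^sup>2
    = 2 * (ip_norm ip f)\<^sup>2 + 2 * (ip_norm ip g)\<^sup>2"
proof -
  have m: "cscale (-1) g \<in> H"
    using assms cscale_mem by blast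
  have "f - g = f + cscale (-1) g"
    by (simp add: cscale_def fun_eq_iff)
  moreover have "ip_norm ip (cscale (-1) g) = ip_norm ip g"
    by (subst ip_norm_cscale) (simp_all add: assms)
  moreover have "ip f (cscale (-1) g) = - ip f g"
    by (subst ip_cscale_right) (simp_all add: assms)
  ultimately show ?thesis
    using ip_norm_add_sq[OF assms] ip_norm_add_sq[OF assms(1) m] by simp
qed

lemma Metric_space_ip_dist: "Metric_space H (ip_dist H ip)"
proof
  fix f g h
  show "0 \<le> ip_dist H ip f g"
    by (simp add: ip_dist_def diff_mem ip_norm_nonneg)
  show "ip_dist H ip f g = ip_dist H ip g f"
    by (simp add: ip_dist_def ip_norm_diff_commute)
  assume f: "f \<in> H" and g: "g \<in> H"
  then show "ip_dist H ip f g = 0 \<longleftrightarrow> f = g"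
    by (simp add: ip_dist_def ip_norm_eq_0_iff diff_mem)
  assume h: "h \<in> H"
  show "ip_dist H ip f h \<le> ip_dist H ip f g + ip_dist H ip g h"
    using ip_norm_triangle[OF diff_mem[OF f g] diff_mem[OF g h]] f g h
    by (simp add: ip_dist_def)
qed

lemma limitin_norm_topology:
  assumes "\<And>n. \<sigma> n \<in> H"
  shows "limitin (norm_topology H ip) \<sigma> l sequentially
    \<longleftrightarrow> l \<in> H \<and> (\<lambda>n. ip_norm ip (\<sigma> n - l)) \<longlonglongrightarrow> 0"
proof -
  interpret Metric_space H "ip_dist H ip"
    by (rule Metric_space_ip_dist)
  show ?thesis
    using assms
    by (auto simp: norm_topology_def limitin_metric_dist_null ip_dist_def)
qed

lemma closedin_norm_topology:
  "closedin (norm_topology H ip) S \<longleftrightarrow> S \<subseteq> H \<and>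
    (\<forall>\<sigma> l. (\<forall>n. \<sigma> n \<in> S) \<longrightarrow> l \<in> H \<longrightarrow> (\<lambda>n. ip_norm ip (\<sigma> n - l)) \<longlonglongrightarrow> 0 \<longrightarrow> l \<in> S)"
proof -
  interpret Metric_space H "ip_dist H ip"
    by (rule Metric_space_ip_dist)
  have "(\<forall>\<sigma> l. range \<sigma> \<subseteq> S \<and> limitin (norm_topology H ip) \<sigma> l sequentially \<longrightarrow> l \<in> S) \<longleftrightarrow>
    (\<forall>\<sigma> l. (\<forall>n. \<sigma> n \<in> S) \<longrightarrow> l \<in> H \<longrightarrow> (\<lambda>n. ip_norm ip (\<sigma> n - l)) \<longlonglongrightarrow> 0 \<longrightarrow> l \<in> S)"
    if "S \<subseteq> H"
  proof -
    have "limitin (norm_topology H ip) \<sigma> l sequentially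
        \<longleftrightarrow> l \<in> H \<and> (\<lambda>n. ip_norm ip (\<sigma> n - l)) \<longlonglongrightarrow> 0" if "\<forall>n. \<sigma> n \<in> S" for \<sigma> l
      using that \<open>S \<subseteq> H\<close> by (intro limitin_norm_topology) auto
    then show ?thesis
      by (auto simp: image_subset_iff)
  qed
  then show ?thesis
    unfolding norm_topology_def metric_closedin_iff_sequentially_closed by blast
qed

lemma in_closure_of_norm_topology:
  assumes "S \<subseteq> H"
  shows "x \<in> norm_topology H ip closure_of S \<longleftrightarrow>
    x \<in> H \<and> (\<exists>\<sigma>. (\<forall>n. \<sigma> n \<in> S) \<and> (\<lambda>n. ip_norm ip (\<sigma> n - x)) \<longlonglongrightarrow> 0)"
proof -
  interpret Metric_space H "ip_dist H ip"
    by (rule Metric_space_ip_dist)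
  have "limitin (norm_topology H ip) \<sigma> x sequentially
      \<longleftrightarrow> x \<in> H \<and> (\<lambda>n. ip_norm ip (\<sigma> n - x)) \<longlonglongrightarrow> 0" if "\<forall>n. \<sigma> n \<in> S" for \<sigma>
    using that assms by (intro limitin_norm_topology) auto
  then show ?thesis
    using assms unfolding norm_topology_def closure_of_sequentially
    by (fastforce simp: image_subset_iff)
qed

lemma tendsto_ip_right:
  assumes "\<And>n. \<sigma> n \<in> H" "l \<in> H" "f \<in> H" "(\<lambda>n. ip_norm ip (\<sigma> n - l)) \<longlonglongrightarrow> 0"
  shows "(\<lambda>n. ip f (\<sigma> n)) \<longlonglongrightarrow> ip f l"
proof -
  have "(\<lambda>n. ip_norm ip f * ip_norm ip (\<sigma> n - l)) \<longlonglongrightarrow> 0"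
    using tendsto_mult_left[OF assms(4), of "ip_norm ip f"] by simp
  moreover have "cmod (ip f (\<sigma> n) - ip f l) \<le> ip_norm ip f * ip_norm ip (\<sigma> n - l)" for n
    using Cauchy_Schwarz_ip[of f "\<sigma> n - l"] assms by (simp add: ip_diff_right diff_mem)
  ultimately have "(\<lambda>n. ip f (\<sigma> n) - ip f l) \<longlonglongrightarrow> 0"
    by (intro Lim_null_comparison[where f = "\<lambda>n. ip f (\<sigma> n) - ip f l"] always_eventually) auto
  then show ?thesis
    by (rule LIM_zero_cancel)
qed

text \<open>The projection theorem.  A minimising sequence for the distance from \<open>x\<close> to \<open>M\<close> is Cauchy by
  the parallelogram law, because the midpoint of two of its members lies in \<open>M\<close>; its limit is a
  nearest point, and subtracting from the residual its component along any \<open>y \<in> M\<close> cannot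
  shorten it.\<close>

lemma orthogonal_projection_exists:
  assumes M: "closedin (norm_topology H ip) M" "cfun.subspace M" and x: "x \<in> H"
  obtains m where "m \<in> M" "\<And>y. y \<in> M \<Longrightarrow> ip (x - m) y = 0"
proof -
  interpret Metric_space H "ip_dist H ip"
    by (rule Metric_space_ip_dist)
  have MH: "M \<subseteq> H"
    using M(1) closedin_norm_topology by blast
  have addM: "f + g \<in> M" and scaleM: "cscale c f \<in> M" if "f \<in> M" "g \<in> M" for f g c
    using that M(2) cfun.subspace_add cfun.subspace_scale by blast+
  define S where "S = (\<lambda>m. (ip_norm ip (x - m))\<^sup>2) ` M"
  define \<delta> where "\<delta> = Inf S"
  have S_ne: "S \<noteq> {}"
    using cfun.subspace_0[OF M(2)] by (auto simp: S_def)
  have S_bdd: "bdd_below S"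
    by (rule bdd_belowI[of _ 0]) (auto simp: S_def)
  have \<delta>_le: "\<delta> \<le> (ip_norm ip (x - m))\<^sup>2" if "m \<in> M" for m
    unfolding \<delta>_def using that S_bdd by (intro cInf_lower) (auto simp: S_def)
  have \<delta>_nonneg: "0 \<le> \<delta>"
    unfolding \<delta>_def using S_ne by (intro cInf_greatest) (auto simp: S_def)
  have "\<exists>m\<in>M. (ip_norm ip (x - m))\<^sup>2 < \<delta> + inverse (real (Suc n))" for n
    using cInf_lessD[OF S_ne, of "\<delta> + inverse (real (Suc n))"] by (auto simp: S_def \<delta>_def)
  then obtain \<mu> where \<mu>: "\<And>n. \<mu> n \<in> M"
      "\<And>n. (ip_norm ip (x - \<mu> n))\<^sup>2 < \<delta> + inverse (real (Suc n))"
    by metis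
  have \<mu>H: "\<mu> n \<in> H" for n
    using \<mu>(1) MH by blast
  have gap: "(ip_norm ip (\<mu> k - \<mu> n))\<^sup>2 < 2 * inverse (real (Suc k)) + 2 * inverse (real (Suc n))"
    for k n
  proof -
    let ?mid = "cscale (1/2) (\<mu> k + \<mu> n)"
    have mid: "?mid \<in> M"
      using \<mu>(1) addM scaleM by blast
    have "(x - \<mu> n) + (x - \<mu> k) = cscale 2 (x - ?mid)"
      by (simp add: cscale_def fun_eq_iff field_simps)
    then have "(ip_norm ip ((x - \<mu> n) + (x - \<mu> k)))\<^sup>2 = 4 * (ip_norm ip (x - ?mid))\<^sup>2"
      using mid MH x by (simp add: ip_norm_cscale diff_mem subset_iff power_mult_distrib)
    then show ?thesis
      using parallelogram_law[OF diff_mem[OF x \<mu>H[of n]] diff_mem[OF x \<mu>H[of k]]]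
        \<delta>_le[OF mid] \<mu>(2)[of k] \<mu>(2)[of n] by simp
  qed
  have "MCauchy \<mu>"
    unfolding MCauchy_def
  proof (intro conjI allI impI)
    show "range \<mu> \<subseteq> H"
      using \<mu>H by blast
    fix \<epsilon> :: real
    assume \<epsilon>: "0 < \<epsilon>"
    then obtain N where N: "inverse (real (Suc N)) < \<epsilon>\<^sup>2 / 4"
      using reals_Archimedean[of "\<epsilon>\<^sup>2 / 4"] by auto
    have "ip_dist H ip (\<mu> n) (\<mu> n') < \<epsilon>" if "N \<le> n" "N \<le> n'" for n n'
    proof -
      have "inverse (real (Suc n)) \<le> inverse (real (Suc N))"
        "inverse (real (Suc n')) \<le> inverse (real (Suc N))"
        using that by (auto intro: le_imp_inverse_le)
      then have "(ip_norm ip (\<mu> n - \<mu> n'))\<^sup>2 < \<epsilon>\<^sup>2"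
        using gap[of n n'] N by linarith
      then show ?thesis
        using \<epsilon> \<mu>H by (simp add: ip_dist_def power_less_imp_less_base)
    qed
    then show "\<exists>N. \<forall>n n'. N \<le> n \<longrightarrow> N \<le> n' \<longrightarrow> ip_dist H ip (\<mu> n) (\<mu> n') < \<epsilon>"
      by blast
  qed
  then obtain m where "limitin (norm_topology H ip) \<mu> m sequentially"
    using complete by (auto simp: mcomplete_def norm_topology_def)
  then have mH: "m \<in> H" and lim: "(\<lambda>n. ip_norm ip (\<mu> n - m)) \<longlonglongrightarrow> 0"
    using limitin_norm_topology \<mu>H by blast+
  then have mM: "m \<in> M"
    using M(1) \<mu>(1) closedin_norm_topology by blast
  have "ip_norm ip (x - m) \<le> sqrt \<delta>"
  proof (rule LIMSEQ_le_const)
    have "(\<lambda>n. sqrt (\<delta> + inverse (real (Suc n))) + ip_norm ip (\<mu> n - m)) \<longlonglongrightarrow> sqrt (\<delta> + 0) + 0"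
      by (intro tendsto_intros lim LIMSEQ_inverse_real_of_nat)
    then show "(\<lambda>n. sqrt (\<delta> + inverse (real (Suc n))) + ip_norm ip (\<mu> n - m)) \<longlonglongrightarrow> sqrt \<delta>"
      by simp
    have "ip_norm ip (x - m) \<le> sqrt (\<delta> + inverse (real (Suc n))) + ip_norm ip (\<mu> n - m)" for n
    proof -
      have "ip_norm ip (x - \<mu> n) \<le> sqrt (\<delta> + inverse (real (Suc n)))"
        using \<mu>(2)[of n] by (simp add: real_le_rsqrt)
      then show ?thesis
        using ip_norm_triangle[OF diff_mem[OF x \<mu>H[of n]] diff_mem[OF \<mu>H[of n] mH]] by simp
    qed
    then show "\<exists>N. \<forall>n\<ge>N. ip_norm ip (x - m)
        \<le> sqrt (\<delta> + inverse (real (Suc n))) + ip_norm ip (\<mu> n - m)"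
      by blast
  qed
  then have nearest: "(ip_norm ip (x - m))\<^sup>2 \<le> \<delta>"
    using power_mono[of "ip_norm ip (x - m)" "sqrt \<delta>" 2] x mH \<delta>_nonneg
    by (simp add: ip_norm_nonneg diff_mem)
  have "ip (x - m) y = 0" if y: "y \<in> M" for y
  proof (cases "y = 0")
    case True
    then show ?thesis
      using x mH by (simp add: ip_zero_right diff_mem)
  next
    case False
    have yH: "y \<in> H"
      using y MH by blast
    let ?t = "ip (x - m) y / ip y y"
    have "m + cscale ?t y \<in> M"
      using y mM addM scaleM by blast
    then have "\<delta> \<le> (ip_norm ip (x - m - cscale ?t y))\<^sup>2"
      using \<delta>_le[of "m + cscale ?t y"] by (simp add: diff_diff_eq)
    then have "(cmod (ip (x - m) y))\<^sup>2 / (ip_norm ip y)\<^sup>2 \<le> 0"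
      using ip_norm_residual[OF diff_mem[OF x mH] yH False] nearest by linarith
    then show ?thesis
      using False yH ip_norm_eq_0_iff by (simp add: divide_le_0_iff power2_less_0)
  qed
  then show thesis
    using that mM by blast
qed

end

section \<open>Adjoining a vector as a new point\<close>

text \<open>The graph of the operator \<open>h \<mapsto> \<phi> h\<close>.  Stating everything for pairs in the graph avoids choosing
  the image of \<open>h\<close>, which is determined because \<open>dom \<phi>\<close> is a set of uniqueness.\<close>

definition multiplier_pair ::
  "('a \<Rightarrow> complex) set \<Rightarrow> ('a \<rightharpoonup> complex) \<Rightarrow> ('a \<Rightarrow> complex) \<Rightarrow> ('a \<Rightarrow> complex) \<Rightarrow> bool" where
  "multiplier_pair H \<phi> h g \<longleftrightarrow> h \<in> H \<and> g \<in> H \<and> (\<forall>x\<in>dom \<phi>. g x = the (\<phi> x) * h x)"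

lemma mult_domain_iff: "h \<in> mult_domain H \<phi> \<longleftrightarrow> (\<exists>g. multiplier_pair H \<phi> h g)"
  by (auto simp: mult_domain_def multiplier_pair_def)

lemma multiplier_pair_mem:
  assumes "multiplier_pair H \<phi> h g"
  shows "h \<in> H" "g \<in> H"
  using assms by (auto simp: multiplier_pair_def)

lemma multiplier_pair_unique:
  assumes "uniqueness_set \<Omega> H (dom \<phi>)" "multiplier_pair H \<phi> h g" "multiplier_pair H \<phi> h g'"
  shows "g = g'"
  using assms unfolding uniqueness_set_def multiplier_pair_def by simp

lemma ext_fun_comp_Some [simp]: "ext_fun ip v f \<circ> Some = f"
  by (simp add: ext_fun_def fun_eq_iff)

lemma ext_fun_Some [simp]: "ext_fun ip v f (Some x) = f x"
  by (simp add: ext_fun_def)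

lemma ext_fun_None [simp]: "ext_fun ip v f None = ip f v"
  by (simp add: ext_fun_def)

context hilbert_function_space
begin

lemma ext_fun_add:
  assumes "f \<in> H" "g \<in> H" "v \<in> H"
  shows "ext_fun ip v (f + g) = ext_fun ip v f + ext_fun ip v g"
  using assms by (auto simp: ext_fun_def fun_eq_iff ip_add split: option.split)

lemma ext_fun_cscale:
  assumes "f \<in> H" "v \<in> H"
  shows "ext_fun ip v (cscale c f) = cscale c (ext_fun ip v f)"
proof
  fix x
  show "ext_fun ip v (cscale c f) x = cscale c (ext_fun ip v f) x"
    using ip_cscale[OF assms] by (cases x) (auto simp: cscale_def)
qed

lemma ext_fun_zero: "v \<in> H \<Longrightarrow> ext_fun ip v 0 = 0"
  by (auto simp: ext_fun_def fun_eq_iff ip_zero_left split: option.split)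

lemma ip_dist_ext_fun:
  assumes "f \<in> H" "g \<in> H"
  shows "ip_dist (ext_space H ip v) (ext_ip ip) (ext_fun ip v f) (ext_fun ip v g) = ip_dist H ip f g"
proof -
  have "(ext_fun ip v f - ext_fun ip v g) \<circ> Some = f - g"
    by (simp add: fun_eq_iff)
  then show ?thesis
    using assms by (simp add: ip_dist_def ip_norm_def ext_ip_def ext_space_def)
qed

text \<open>By the preceding lemma restriction to \<open>\<Omega>\<close> is an isometry of \<open>\<H>\<^sub>v\<close> onto \<open>\<H>\<close>, so the metric
  axioms and closedness carry over.\<close>

lemma Metric_space_ext_space: "Metric_space (ext_space H ip v) (ip_dist (ext_space H ip v) (ext_ip ip))"
  (is "Metric_space ?K ?d")
proof -
  interpret Metric_space H "ip_dist H ip"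
    by (rule Metric_space_ip_dist)
  have inj: "ext_fun ip v f = ext_fun ip v g \<longleftrightarrow> f = g" for f g
    by (metis ext_fun_comp_Some)
  show ?thesis
  proof
    fix F G K
    show "0 \<le> ?d F G"
    proof (cases "F \<in> ?K \<and> G \<in> ?K")
      case True
      then show ?thesis
        by (auto simp: ext_space_def ip_dist_ext_fun[unfolded ext_space_def])
    qed (auto simp: ip_dist_def)
    show "?d F G = ?d G F"
    proof (cases "F \<in> ?K \<and> G \<in> ?K")
      case True
      then show ?thesis
        by (auto simp: ext_space_def ip_dist_ext_fun[unfolded ext_space_def] commute)
    qed (auto simp: ip_dist_def)
    assume F: "F \<in> ?K" and G: "G \<in> ?K"
    then show "?d F G = 0 \<longleftrightarrow> F = G"
      by (auto simp: ext_space_def ip_dist_ext_fun[unfolded ext_space_def] inj)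
    assume "K \<in> ?K"
    then show "?d F K \<le> ?d F G + ?d G K"
      using F G by (auto simp: ext_space_def ip_dist_ext_fun[unfolded ext_space_def] triangle)
  qed
qed

lemma closedin_ext_fun_image:
  assumes "closedin (norm_topology H ip) S"
  shows "closedin (norm_topology (ext_space H ip v) (ext_ip ip)) (ext_fun ip v ` S)"
proof -
  interpret M: Metric_space H "ip_dist H ip"
    by (rule Metric_space_ip_dist)
  interpret K: Metric_space "ext_space H ip v" "ip_dist (ext_space H ip v) (ext_ip ip)"
    by (rule Metric_space_ext_space)
  have S: "S \<subseteq> H" and
    sep: "\<And>f. f \<in> H \<Longrightarrow> f \<notin> S \<Longrightarrow> \<exists>r>0. disjnt S (M.mball f r)"
    using assms unfolding norm_topology_def M.closedin_metric by auto
  show ?thesis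
    unfolding norm_topology_def K.closedin_metric
  proof (intro conjI allI impI)
    show "ext_fun ip v ` S \<subseteq> ext_space H ip v"
      using S by (auto simp: ext_space_def)
    fix F
    assume "F \<in> ext_space H ip v - ext_fun ip v ` S"
    then obtain f where F: "F = ext_fun ip v f" and f: "f \<in> H" "f \<notin> S"
      by (auto simp: ext_space_def)
    then obtain r where r: "r > 0" "disjnt S (M.mball f r)"
      using sep by blast
    have "disjnt (ext_fun ip v ` S) (K.mball F r)"
      unfolding disjnt_iff
    proof (intro allI notI, elim conjE imageE)
      fix G s
      assume G: "G \<in> K.mball F r" "G = ext_fun ip v s" and s: "s \<in> S"
      then have "s \<in> M.mball f r"
        using f S by (auto simp: F ip_dist_ext_fun)
      then show False
        using r(2) s by (auto simp: disjnt_iff)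
    qed
    then show "\<exists>r>0. disjnt (ext_fun ip v ` S) (K.mball F r)"
      using r(1) by blast
  qed
qed

lemma ext_fun_span:
  assumes "B \<subseteq> H" "v \<in> H" "b \<in> cfun.span B"
  shows "b \<in> H \<and> ext_fun ip v b \<in> cfun.span (ext_fun ip v ` B)"
  using assms(3)
proof (rule cfun.span_induct)
  show "cfun.subspace {b. b \<in> H \<and> ext_fun ip v b \<in> cfun.span (ext_fun ip v ` B)}"
    unfolding cfun.subspace_def
    using assms(2) by (auto simp: zero_mem add_mem cscale_mem ext_fun_zero ext_fun_add ext_fun_cscale
        cfun.span_zero intro: cfun.span_add cfun.span_scale)
qed (use assms(1) in \<open>auto intro: cfun.span_base\<close>)

lemma finite_codimension_ext_fun_image:
  assumes "finite_codimension H E" "v \<in> H"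
  shows "finite_codimension (ext_space H ip v) (ext_fun ip v ` E)"
proof -
  obtain B where E: "cfun.subspace E" "E \<subseteq> H" and B: "finite B" "B \<subseteq> H"
    and dec: "\<And>h. h \<in> H \<Longrightarrow> \<exists>e\<in>E. \<exists>b\<in>cfun.span B. h = e + b"
    using assms(1) by (auto simp: finite_codimension_def)
  have "cfun.subspace (ext_fun ip v ` E)"
    unfolding cfun.subspace_def
  proof (intro conjI ballI allI)
    show "0 \<in> ext_fun ip v ` E"
      using cfun.subspace_0[OF E(1)] ext_fun_zero[OF assms(2)] by (metis imageI)
    fix F assume F: "F \<in> ext_fun ip v ` E"
    show "cscale c F \<in> ext_fun ip v ` E" for c
      using F E assms(2) ext_fun_cscale cfun.subspace_scale[OF E(1)]
      by (smt (verit) imageE imageI subsetD)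
    fix G assume "G \<in> ext_fun ip v ` E"
    then show "F + G \<in> ext_fun ip v ` E"
      using F E assms(2) ext_fun_add cfun.subspace_add[OF E(1)]
      by (smt (verit) imageE imageI subsetD)
  qed
  moreover have "\<exists>e\<in>ext_fun ip v ` E. \<exists>b\<in>cfun.span (ext_fun ip v ` B). F = e + b"
    if F: "F \<in> ext_space H ip v" for F
  proof -
    obtain h where h: "h \<in> H" "F = ext_fun ip v h"
      using F by (auto simp: ext_space_def)
    then obtain e b where eb: "e \<in> E" "b \<in> cfun.span B" "h = e + b"
      using dec by blast
    have b: "b \<in> H" "ext_fun ip v b \<in> cfun.span (ext_fun ip v ` B)"
      using ext_fun_span[OF B(2) assms(2) eb(2)] by auto
    have "F = ext_fun ip v e + ext_fun ip v b"
      using h eb b E assms(2) by (auto simp: ext_fun_add)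
    then show ?thesis
      using eb(1) b(2) by blast
  qed
  ultimately show ?thesis
    unfolding finite_codimension_def using E(2) B
    by (intro conjI exI[of _ "ext_fun ip v ` B"]) (auto simp: ext_space_def)
qed

text \<open>An extension \<open>\<psi>\<close> of \<open>\<phi>\<close> with value \<open>c\<close> at \<open>p\<close> must not shrink the domain space, so every pair
  \<open>(h, g)\<close> of the graph of \<open>\<phi>\<close> has to satisfy the equation that \<open>\<psi>\<close> imposes at \<open>p\<close>.
  Conversely, under that condition the smallest extension, to \<open>dom \<phi> \<union> {p}\<close>, has the same domain
  space as \<open>\<phi>\<close>, and the isometry transports closedness and finite codimension.\<close>

lemma sees_with_value_iff:
  assumes \<phi>: "pseudomultiplier \<Omega> H ip \<phi>" and v: "v \<in> H"
  shows "sees_with_value \<Omega> H ip \<phi> v c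
    \<longleftrightarrow> (\<forall>h g. multiplier_pair H \<phi> h g \<longrightarrow> ip g v = c * ip h v)"
proof
  have uniq: "uniqueness_set \<Omega> H (dom \<phi>)"
    and closed: "closedin (norm_topology H ip) (mult_domain H \<phi>)"
    and codim: "finite_codimension H (mult_domain H \<phi>)"
    using \<phi> by (auto simp: pseudomultiplier_def)
  {
    assume "sees_with_value \<Omega> H ip \<phi> v c"
    then obtain \<psi> where \<psi>: "Some ` dom \<phi> \<subseteq> dom \<psi>" "\<And>x. x \<in> dom \<phi> \<Longrightarrow> \<psi> (Some x) = \<phi> x"
        "\<psi> None = Some c"
        "mult_domain H \<phi> = (\<lambda>F. F \<circ> Some) ` mult_domain (ext_space H ip v) \<psi>"
      by (auto simp: sees_with_value_def)
    show "\<forall>h g. multiplier_pair H \<phi> h g \<longrightarrow> ip g v = c * ip h v"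
    proof (intro allI impI)
      fix h g
      assume hg: "multiplier_pair H \<phi> h g"
      then have "h \<in> (\<lambda>F. F \<circ> Some) ` mult_domain (ext_space H ip v) \<psi>"
        using \<psi>(4) mult_domain_iff by metis
      then obtain F G where F: "h = F \<circ> Some" "multiplier_pair (ext_space H ip v) \<psi> F G"
        by (auto simp: mult_domain_iff)
      then have F_eq: "F = ext_fun ip v h"
        by (auto simp: multiplier_pair_def ext_space_def)
      obtain g' where g': "g' \<in> H" "G = ext_fun ip v g'"
        using F by (auto simp: multiplier_pair_def ext_space_def)
      have G: "G y = the (\<psi> y) * F y" if "y \<in> dom \<psi>" for y
        using F(2) that by (auto simp: multiplier_pair_def)
      have "g' x = the (\<phi> x) * h x" if "x \<in> dom \<phi>" for x
        using G[of "Some x"] that \<psi>(1,2) by (auto simp: F_eq g')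
      then have "multiplier_pair H \<phi> h g'"
        using hg g' by (auto simp: multiplier_pair_def)
      then have "g' = g"
        using multiplier_pair_unique[OF uniq] hg by blast
      then show "ip g v = c * ip h v"
        using G[of None] \<psi>(3) by (auto simp: F_eq g')
    qed
  next
    assume eq: "\<forall>h g. multiplier_pair H \<phi> h g \<longrightarrow> ip g v = c * ip h v"
    define \<psi> where "\<psi> = case_option (Some c) \<phi>"
    have dom: "dom \<psi> = insert None (Some ` dom \<phi>)"
    proof (rule set_eqI)
      fix y
      show "y \<in> dom \<psi> \<longleftrightarrow> y \<in> insert None (Some ` dom \<phi>)"
        by (cases y) (auto simp: \<psi>_def)
    qed
    have pair_iff: "multiplier_pair (ext_space H ip v) \<psi> (ext_fun ip v h) (ext_fun ip v g)
        \<longleftrightarrow> multiplier_pair H \<phi> h g" if "h \<in> H" "g \<in> H" for h g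
      using that eq unfolding multiplier_pair_def dom
      by (auto simp: \<psi>_def ext_space_def)
    have E: "mult_domain (ext_space H ip v) \<psi> = ext_fun ip v ` mult_domain H \<phi>"
    proof (intro equalityI subsetI)
      fix F
      assume "F \<in> mult_domain (ext_space H ip v) \<psi>"
      then obtain G where FG: "multiplier_pair (ext_space H ip v) \<psi> F G"
        by (auto simp: mult_domain_iff)
      then obtain h g where "F = ext_fun ip v h" "G = ext_fun ip v g" "h \<in> H" "g \<in> H"
        by (auto simp: multiplier_pair_def ext_space_def)
      then show "F \<in> ext_fun ip v ` mult_domain H \<phi>"
        using FG pair_iff mult_domain_iff by blast
    next
      fix F
      assume "F \<in> ext_fun ip v ` mult_domain H \<phi>"
      then obtain h g where "F = ext_fun ip v h" "multiplier_pair H \<phi> h g"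
        by (auto simp: mult_domain_iff)
      then show "F \<in> mult_domain (ext_space H ip v) \<psi>"
        using pair_iff multiplier_pair_mem mult_domain_iff by metis
    qed
    have "uniqueness_set (ext_points \<Omega>) (ext_space H ip v) (dom \<psi>)"
      using uniq unfolding uniqueness_set_def dom ext_points_def ext_space_def
      by (auto simp: subset_iff)
    then have "pseudomultiplier (ext_points \<Omega>) (ext_space H ip v) (ext_ip ip) \<psi>"
      using closedin_ext_fun_image[OF closed] finite_codimension_ext_fun_image[OF codim v]
      by (simp add: pseudomultiplier_def E)
    then show "sees_with_value \<Omega> H ip \<phi> v c"
      unfolding sees_with_value_def
      by (intro exI[of _ \<psi>]) (auto simp: dom E image_image, auto simp: \<psi>_def)
  }
qed

end

section \<open>Ambiguous, definable and polar vectors\<close>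

locale hilbert_pseudomultiplier = hilbert_function_space +
  fixes \<phi> :: "'a \<rightharpoonup> complex"
  assumes pseudo: "pseudomultiplier \<Omega> H ip \<phi>"
begin

abbreviation amb :: "('a \<Rightarrow> complex) set" where
  "amb \<equiv> ambiguous_vectors \<Omega> H ip \<phi>"

abbreviation defn :: "('a \<Rightarrow> complex) set" where
  "defn \<equiv> definable_vectors \<Omega> H ip \<phi>"

abbreviation val :: "('a \<Rightarrow> complex) \<Rightarrow> complex" where
  "val \<equiv> value_at \<Omega> H ip \<phi>"

abbreviation pair :: "('a \<Rightarrow> complex) \<Rightarrow> ('a \<Rightarrow> complex) \<Rightarrow> bool" where
  "pair \<equiv> multiplier_pair H \<phi>"

lemma dom_uniqueness: "uniqueness_set \<Omega> H (dom \<phi>)"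
  using pseudo by (simp add: pseudomultiplier_def)

lemma ambiguous_iff:
  "v \<in> amb \<longleftrightarrow> v \<in> H \<and> (\<forall>h g. pair h g \<longrightarrow> ip h v = 0 \<and> ip g v = 0)"
proof
  assume "v \<in> amb"
  then have v: "v \<in> H" and all: "\<And>c. sees_with_value \<Omega> H ip \<phi> v c"
    by (auto simp: ambiguous_vectors_def)
  have eq: "ip g v = c * ip h v" if "pair h g" for c h g
    using all[of c] that sees_with_value_iff[OF pseudo v] by blast
  have "ip h v = 0 \<and> ip g v = 0" if "pair h g" for h g
    using eq[OF that, of 0] eq[OF that, of 1] by simp
  then show "v \<in> H \<and> (\<forall>h g. pair h g \<longrightarrow> ip h v = 0 \<and> ip g v = 0)"
    using v by blast
next
  assume "v \<in> H \<and> (\<forall>h g. pair h g \<longrightarrow> ip h v = 0 \<and> ip g v = 0)"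
  then show "v \<in> amb"
    by (auto simp: ambiguous_vectors_def sees_with_value_iff[OF pseudo])
qed

lemma definable_iff:
  "d \<in> defn \<longleftrightarrow> d \<in> H \<and> d \<noteq> 0 \<and> (\<exists>c. \<forall>h g. pair h g \<longrightarrow> ip g d = c * ip h d)
    \<and> (\<forall>a\<in>amb. ip d a = 0)"
  by (auto simp: definable_vectors_def sees_def sees_with_value_iff[OF pseudo])

lemma definable_mem: "d \<in> defn \<Longrightarrow> d \<in> H"
  by (simp add: definable_iff)

lemma definable_cscale:
  assumes "d \<in> defn" "t \<noteq> 0"
  shows "cscale t d \<in> defn"
proof -
  obtain c where d: "d \<in> H" "d \<noteq> 0" "\<And>a. a \<in> amb \<Longrightarrow> ip d a = 0"
    and c: "\<And>h g. pair h g \<Longrightarrow> ip g d = c * ip h d"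
    using assms(1) definable_iff by metis
  have "ip g (cscale t d) = c * ip h (cscale t d)" if "pair h g" for h g
    using c[OF that] multiplier_pair_mem[OF that] d(1) by (simp add: ip_cscale_right)
  moreover have "ip (cscale t d) a = 0" if "a \<in> amb" for a
    using that d ambiguous_iff ip_cscale by auto
  ultimately show ?thesis
    using d assms(2) cscale_mem unfolding definable_iff by auto
qed

text \<open>A vector that is both ambiguous and orthogonal to all ambiguous vectors is orthogonal to
  itself; hence two values at \<open>d\<close> would force \<open>d = 0\<close>.\<close>

lemma orthogonal_ambiguous_eq_0:
  assumes "d \<in> amb" "\<And>a. a \<in> amb \<Longrightarrow> ip d a = 0"
  shows "d = 0"
  using assms ambiguous_iff ip_self_eq_0_iff by blast

lemma definable_value:
  assumes d: "d \<in> defn" and hg: "pair h g"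
  shows "ip g d = val d * ip h d"
proof -
  have dH: "d \<in> H"
    using d definable_mem by blast
  obtain c where c: "sees_with_value \<Omega> H ip \<phi> d c"
    using d by (auto simp: definable_vectors_def sees_def)
  have "c' = c" if c': "sees_with_value \<Omega> H ip \<phi> d c'" for c'
  proof (rule ccontr)
    assume ne: "c' \<noteq> c"
    have "ip h d = 0 \<and> ip g d = 0" if "pair h g" for h g
      using c c' that ne unfolding sees_with_value_iff[OF pseudo dH]
      by (metis mult_cancel_right mult_zero_right)
    then have "d \<in> amb"
      using dH ambiguous_iff by blast
    then show False
      using d orthogonal_ambiguous_eq_0 unfolding definable_iff by blast
  qed
  then have "val d = c"
    unfolding value_at_def using c by (intro the_equality)
  then show ?thesis
    using c hg sees_with_value_iff[OF pseudo dH] by blast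
qed

lemma limit_of_definable_orthogonal_ambiguous:
  assumes "\<And>n. d n \<in> defn" "q \<in> H" "(\<lambda>n. ip_norm ip (d n - q)) \<longlonglongrightarrow> 0" "a \<in> amb"
  shows "ip q a = 0"
proof -
  have aH: "a \<in> H"
    using assms(4) ambiguous_iff by blast
  have "ip a (d n) = 0" for n
    using assms(1)[of n] assms(4) aH ip_cnj[of "d n" a] definable_iff by auto
  then have "ip a q = 0"
    using tendsto_ip_right[OF definable_mem[OF assms(1)] assms(2) aH assms(3)]
    by (simp add: LIMSEQ_const_iff)
  then show ?thesis
    using ip_cnj[OF aH assms(2)] by simp
qed

text \<open>Dividing \<open>\<langle>g, d\<^sub>n\<rangle> = \<phi>(d\<^sub>n) \<langle>h, d\<^sub>n\<rangle>\<close> by the values, which tend to infinity, shows that a polar vector is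
  orthogonal to the domain of \<open>\<phi>\<close>.  If it were also definable, it would be orthogonal to the range
  as well, hence ambiguous.\<close>

lemma polar_not_definable:
  assumes q: "polar_vector \<Omega> H ip \<phi> q"
  shows "q \<notin> defn"
proof
  assume qD: "q \<in> defn"
  obtain d where qH: "q \<in> H" "q \<noteq> 0" and d: "\<And>n. d n \<in> defn"
    and lim: "(\<lambda>n. ip_norm ip (d n - q)) \<longlonglongrightarrow> 0"
    and inf: "filterlim (\<lambda>n. val (d n)) at_infinity sequentially"
    using q by (auto simp: polar_vector_def)
  have "ip h q = 0" if hg: "pair h g" for h g
  proof -
    note mem = multiplier_pair_mem[OF hg]
    have "(\<lambda>n. ip g (d n) * inverse (val (d n))) \<longlonglongrightarrow> ip g q * 0"
      by (intro tendsto_mult tendsto_ip_right definable_mem d qH lim mem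
          filterlim_compose[OF tendsto_inverse_0 inf])
    moreover have "\<forall>\<^sub>F n in sequentially. ip g (d n) * inverse (val (d n)) = ip h (d n)"
      using filterlim_at_infinity_imp_eventually_ne[OF inf, of 0]
      by eventually_elim (simp add: definable_value[OF d hg])
    ultimately have "(\<lambda>n. ip h (d n)) \<longlonglongrightarrow> 0"
      by (simp add: tendsto_cong)
    moreover have "(\<lambda>n. ip h (d n)) \<longlonglongrightarrow> ip h q"
      by (intro tendsto_ip_right definable_mem d qH lim mem)
    ultimately show ?thesis
      using LIMSEQ_unique by blast
  qed
  then have "q \<in> amb"
    using definable_value[OF qD] qH ambiguous_iff by auto
  then show False
    using qD orthogonal_ambiguous_eq_0 unfolding definable_iff by blast
qed

text \<open>If the values did not tend to infinity, they would have a convergent subsequence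
  (Bolzano--Weierstrass), and passing to the limit along it would make \<open>q\<close> definable.\<close>

lemma limit_of_definable_values_tend_to_infinity:
  assumes d: "\<And>n. d n \<in> defn" and q: "q \<in> H" "q \<noteq> 0" "q \<notin> defn"
    and lim: "(\<lambda>n. ip_norm ip (d n - q)) \<longlonglongrightarrow> 0"
  shows "filterlim (\<lambda>n. val (d n)) at_infinity sequentially"
proof (rule ccontr)
  assume "\<not> filterlim (\<lambda>n. val (d n)) at_infinity sequentially"
  then obtain r where "\<exists>\<^sub>F n in sequentially. cmod (val (d n)) < r"
    by (auto simp: filterlim_at_infinity[OF order_refl] frequently_def not_le not_less)
  then have "infinite {n. cmod (val (d n)) < r}"
    by (simp flip: cofinite_eq_sequentially add: frequently_cofinite)
  then obtain s :: "nat \<Rightarrow> nat" where s: "strict_mono s" "\<And>n. cmod (val (d (s n))) < r"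
    using infinite_enumerate by blast
  have "bounded (range (\<lambda>n. val (d (s n))))"
    unfolding bounded_iff using s(2) less_imp_le by blast
  then obtain c t where t: "strict_mono t" "((\<lambda>n. val (d (s n))) \<circ> t) \<longlonglongrightarrow> c"
    using bounded_imp_convergent_subsequence by blast
  define u where "u = s \<circ> t"
  have u: "strict_mono u" "(\<lambda>n. val (d (u n))) \<longlonglongrightarrow> c"
    using strict_mono_o[OF s(1) t(1)] t(2) by (simp_all add: u_def o_def)
  have limu: "(\<lambda>n. ip_norm ip (d (u n) - q)) \<longlonglongrightarrow> 0"
    using LIMSEQ_subseq_LIMSEQ[OF lim u(1)] by (simp add: o_def)
  have "ip g q = c * ip h q" if hg: "pair h g" for h g
  proof (rule LIMSEQ_unique)
    note mem = multiplier_pair_mem[OF hg]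
    show "(\<lambda>n. ip g (d (u n))) \<longlonglongrightarrow> ip g q"
      by (intro tendsto_ip_right definable_mem d q limu mem)
    have "(\<lambda>n. val (d (u n)) * ip h (d (u n))) \<longlonglongrightarrow> c * ip h q"
      by (intro tendsto_mult u tendsto_ip_right definable_mem d q limu mem)
    then show "(\<lambda>n. ip g (d (u n))) \<longlonglongrightarrow> c * ip h q"
      by (simp add: definable_value[OF d hg])
  qed
  then have "q \<in> defn"
    using q limit_of_definable_orthogonal_ambiguous[OF d q(1) lim] definable_iff by blast
  then show False
    using q by blast
qed

lemma ambiguous_subspace: "cfun.subspace amb"
proof -
  have "u + v \<in> amb" and "cscale c u \<in> amb" if "u \<in> amb" "v \<in> amb" for u v c
    using that unfolding ambiguous_iff
    by (auto simp: add_mem cscale_mem ip_add_right ip_cscale_right multiplier_pair_mem)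
  moreover have "0 \<in> amb"
    by (auto simp: ambiguous_iff zero_mem ip_zero_right multiplier_pair_mem)
  ultimately show ?thesis
    unfolding cfun.subspace_def by blast
qed

lemma ambiguous_closed: "closedin (norm_topology H ip) amb"
  unfolding closedin_norm_topology
proof (intro conjI allI impI)
  show "amb \<subseteq> H"
    using ambiguous_iff by blast
  fix \<sigma> l
  assume \<sigma>: "\<forall>n. \<sigma> n \<in> amb" and l: "l \<in> H" and lim: "(\<lambda>n. ip_norm ip (\<sigma> n - l)) \<longlonglongrightarrow> 0"
  have "ip f l = 0" if "f \<in> H" "\<And>n. ip f (\<sigma> n) = 0" for f
    using tendsto_ip_right[of \<sigma> l f] \<sigma> l lim that ambiguous_iff
    by (simp add: LIMSEQ_const_iff)
  then show "l \<in> amb"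
    using \<sigma> l ambiguous_iff multiplier_pair_mem by metis
qed

lemma kernel_closed:
  assumes "x \<in> \<Omega>"
  shows "closedin (norm_topology H ip) {f \<in> H. f x = 0}"
proof -
  have "topspace (norm_topology H ip) = H"
    unfolding norm_topology_def
    by (rule Metric_space.topspace_mtopology[OF Metric_space_ip_dist])
  then show ?thesis
    using closedin_continuous_map_preimage[OF continuous_eval[OF assms], of "{0}"] by simp
qed

text \<open>Otherwise the domain of \<open>\<phi>\<close> would vanish on a set of uniqueness, hence be zero, and a zero
  subspace of finite codimension makes \<open>\<H>\<close> finite-dimensional.\<close>

lemma mult_domain_nonvanishing:
  assumes "infinite_dimensional H"
  obtains x h g where "x \<in> dom \<phi>" "pair h g" "h x \<noteq> 0"
proof -
  have "\<exists>x\<in>dom \<phi>. \<exists>h g. pair h g \<and> h x \<noteq> 0"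
  proof (rule ccontr)
    assume none: "\<not> (\<exists>x\<in>dom \<phi>. \<exists>h g. pair h g \<and> h x \<noteq> 0)"
    have E0: "h = 0" if "h \<in> mult_domain H \<phi>" for h
    proof -
      obtain g where hg: "pair h g"
        using \<open>h \<in> mult_domain H \<phi>\<close> mult_domain_iff by blast
      have "h \<in> H" "\<forall>x\<in>dom \<phi>. h x = 0 x"
        using none hg multiplier_pair_mem(1)[OF hg] by (auto simp only: zero_fun_def)
      then show ?thesis
        using dom_uniqueness zero_mem unfolding uniqueness_set_def by blast
    qed
    obtain B where "finite B" "B \<subseteq> H"
      and dec: "\<And>h. h \<in> H \<Longrightarrow> \<exists>e\<in>mult_domain H \<phi>. \<exists>b\<in>cfun.span B. h = e + b"
      using pseudo by (auto simp: pseudomultiplier_def finite_codimension_def)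
    moreover have "H \<subseteq> cfun.span B"
      using dec E0 by fastforce
    ultimately show False
      using assms infinite_dimensional_def by blast
  qed
  then show thesis
    using that by blast
qed

text \<open>At a point \<open>x\<close> of \<open>dom \<phi>\<close> where some function of the domain does not vanish, the component \<open>k\<close> of
  that function orthogonal to the functions vanishing at \<open>x\<close> is a multiple of the reproducing kernel
  at \<open>x\<close>, so \<open>\<phi>\<close> sees \<open>k\<close> with value \<open>\<phi>(x)\<close>.  Removing the ambiguous component of \<open>k\<close> keeps that
  value, and something remains because \<open>k\<close> is not orthogonal to the domain.\<close>

lemma definable_exists:
  assumes "infinite_dimensional H"
  obtains d where "d \<in> defn"
proof -
  obtain x h\<^sub>0 g\<^sub>0 where x: "x \<in> dom \<phi>" and h0: "pair h\<^sub>0 g\<^sub>0" "h\<^sub>0 x \<noteq> 0"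
    using mult_domain_nonvanishing[OF assms] by blast
  note h0H = multiplier_pair_mem(1)[OF h0(1)]
  define c where "c = the (\<phi> x)"
  define N where "N = {f \<in> H. f x = 0}"
  have x\<Omega>: "x \<in> \<Omega>"
    using x dom_uniqueness by (auto simp: uniqueness_set_def)
  have N: "closedin (norm_topology H ip) N" "cfun.subspace N"
    using kernel_closed[OF x\<Omega>]
    by (auto simp: N_def cfun.subspace_def zero_mem add_mem cscale_mem)
      (simp add: cscale_def)
  obtain m where m: "m \<in> N" "\<And>y. y \<in> N \<Longrightarrow> ip (h\<^sub>0 - m) y = 0"
    using orthogonal_projection_exists[OF N h0H] by blast
  define k where "k = h\<^sub>0 - m"
  have mH: "m \<in> H" and kH: "k \<in> H"
    using m h0H by (auto simp: N_def k_def diff_mem)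
  have k_perp: "ip y k = 0" if "y \<in> N" for y
    using m(2)[OF that] ip_cnj[OF kH, of y] that by (auto simp: k_def N_def)
  have k_ne: "k \<noteq> 0"
    using m(1) h0(2) by (auto simp: k_def N_def)
  have k_sees: "ip g k = c * ip h k" if hg: "pair h g" for h g
  proof -
    note mem = multiplier_pair_mem[OF hg]
    have "g - cscale c h \<in> N"
      using diff_mem[OF mem(2) cscale_mem[OF mem(1)], of c] hg x
      by (simp add: N_def c_def multiplier_pair_def) (simp add: cscale_def)
    then show ?thesis
      using k_perp[of "g - cscale c h"] mem kH by (simp add: ip_diff_left ip_cscale cscale_mem)
  qed
  have "ip h\<^sub>0 k = ip k k"
    using k_perp[OF m(1)] ip_diff_left[OF h0H mH kH] by (simp add: k_def)
  then have k_not_amb: "k \<notin> amb"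
    using k_ne kH h0(1) ip_self_eq_0_iff ambiguous_iff by metis
  obtain a where a: "a \<in> amb" "\<And>y. y \<in> amb \<Longrightarrow> ip (k - a) y = 0"
    using orthogonal_projection_exists[OF ambiguous_closed ambiguous_subspace kH] by blast
  have aH: "a \<in> H"
    using a(1) ambiguous_iff by blast
  have "ip g (k - a) = c * ip h (k - a)" if hg: "pair h g" for h g
    using k_sees[OF hg] a(1) hg multiplier_pair_mem[OF hg] kH aH
    by (auto simp: ip_diff_right ambiguous_iff)
  moreover have "k - a \<noteq> 0"
    using k_not_amb a(1) by auto
  ultimately have "k - a \<in> defn"
    unfolding definable_iff using a(2) diff_mem[OF kH aH] by blast
  then show thesis
    using that by blast
qed

lemma zero_in_closure_definable:
  assumes "infinite_dimensional H"
  shows "0 \<in> norm_topology H ip closure_of defn"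
proof -
  obtain d where d: "d \<in> defn"
    using definable_exists[OF assms] by blast
  let ?t = "\<lambda>n. complex_of_real (inverse (real (Suc n)))"
  have "cscale (?t n) d \<in> defn" for n
    using d by (intro definable_cscale) (auto simp del: of_nat_Suc)
  moreover have "(\<lambda>n. inverse (real (Suc n)) * ip_norm ip d) \<longlonglongrightarrow> 0 * ip_norm ip d"
    by (intro tendsto_intros LIMSEQ_inverse_real_of_nat)
  then have "(\<lambda>n. ip_norm ip (cscale (?t n) d - 0)) \<longlonglongrightarrow> 0"
    by (simp add: ip_norm_cscale definable_mem[OF d] norm_inverse del: of_nat_Suc)
  ultimately show ?thesis
    using in_closure_of_norm_topology[of defn 0] definable_mem zero_mem
    by (metis subsetI)
qed

end

theorem theorem2p21:
  fixes \<Omega> :: "'a set"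
    and H :: "('a \<Rightarrow> complex) set"
    and ip :: "('a \<Rightarrow> complex) \<Rightarrow> ('a \<Rightarrow> complex) \<Rightarrow> complex"
    and \<phi> :: "'a \<rightharpoonup> complex"
  assumes "hilbert_function_space \<Omega> H ip"
    and "infinite_dimensional H"
    and "pseudomultiplier \<Omega> H ip \<phi>"
  shows "polar_space \<Omega> H ip \<phi> =
    (norm_topology H ip closure_of definable_vectors \<Omega> H ip \<phi>) - definable_vectors \<Omega> H ip \<phi>"
proof -
  interpret hilbert_pseudomultiplier \<Omega> H ip \<phi>
    using assms by (simp add: hilbert_pseudomultiplier_def hilbert_pseudomultiplier_axioms_def)
  have clo: "x \<in> norm_topology H ip closure_of defn \<longleftrightarrow>
      x \<in> H \<and> (\<exists>\<sigma>. (\<forall>n. \<sigma> n \<in> defn) \<and> (\<lambda>n. ip_norm ip (\<sigma> n - x)) \<longlonglongrightarrow> 0)" for x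
    using definable_mem by (intro in_closure_of_norm_topology) blast
  show ?thesis
  proof (intro equalityI subsetI)
    fix q
    assume q: "q \<in> polar_space \<Omega> H ip \<phi>"
    show "q \<in> (norm_topology H ip closure_of defn) - defn"
    proof (cases "q = 0")
      case True
      then show ?thesis
        using zero_in_closure_definable[OF assms(2)] definable_iff by blast
    next
      case False
      then have "polar_vector \<Omega> H ip \<phi> q"
        using q by (simp add: polar_space_def)
      then show ?thesis
        using polar_not_definable clo by (auto simp: polar_vector_def)
    qed
  next
    fix q
    assume "q \<in> (norm_topology H ip closure_of defn) - defn"
    then obtain d where "q \<in> H" "q \<notin> defn" "\<And>n. d n \<in> defn"
        "(\<lambda>n. ip_norm ip (d n - q)) \<longlonglongrightarrow> 0"
      using clo by blast
    then show "q \<in> polar_space \<Omega> H ip \<phi>"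
      using limit_of_definable_values_tend_to_infinity[of d q]
      by (auto simp: polar_space_def polar_vector_def)
  qed
qed

end
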